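(* Let $\mathcal{F}=\{\mathbb{X};f_1,\dots,f_N\}$ and $\mathcal{G}=\{\mathbb{Y};g_1,\dots,g_N\}$ be two hyperbolic iterated function systems with the same number $N$ of maps, such that $\mathcal{C}_{\mathcal{F}}\prec\mathcal{C}_{\mathcal{G}}$. Then the fractal transformation $\phi_{\mathcal{G}}\circ\tau_{\mathcal{F}}:A_{\mathcal{F}}\to A_{\mathcal{G}}$ is continuous. If $\mathcal{C}_{\mathcal{F}}=\mathcal{C}_{\mathcal{G}}$, then $\phi_{\mathcal{G}}\circ\tau_{\mathcal{F}}$ is a homeomorphism from $A_{\mathcal{F}}$ onto $A_{\mathcal{G}}$.
   Context: A hyperbolic iterated function system (IFS) $\mathcal{F}=\{\mathbb{X};f_1,\dots,f_N\}$ consists of a (nonempty) complete metric space $(\mathbb{X},d)$ and a finite sequence of strictly contractive maps $f_n:\mathbb{X}\to\mathbb{X}$, i.e. for each $n$ there is $l_n\in[0,1)$ with $d(f_n(x),f_n(y))\le l_n d(x,y)$ for all $x,y\in\mathbb{X}$. Code space: $\Omega$ is the set of all infinite sequences $\sigma=\sigma_1\sigma_2\sigma_3\dots$ with entries in $\{1,\dots,N\}$, with metric $d_\Omega(\sigma,\omega)=0$ if $\sigma=\omega$ and $d_\Omega(\sigma,\omega)=2^{-k}$ where $k$ is the least index with $\sigma_k\ne\omega_k$ otherwise; it is a compact metric space. The same $\Omega$ serves for every IFS with $N$ maps. Address function and attractor: for $\sigma\in\Omega$, $\phi_{\mathcal{F}}(\sigma):=\lim_{k\to\infty}f_{\sigma_1}\circ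 f_{\sigma_2}\circ\cdots\circ f_{\sigma_k}(x)$; the limit exists, is independent of $x\in\mathbb{X}$, and depends continuously on $\sigma$. The attractor is $A_{\mathcal{F}}:=\phi_{\mathcal{F}}(\Omega)$, with the metric inherited from $\mathbb{X}$. Ordering: for distinct $\sigma,\omega\in\Omega$, $\sigma<\omega$ iff $\sigma_k>\omega_k$, where $k$ is the least index with $\sigma_k\ne\omega_k$. This is a linear order with largest element $\overline{1}=111\dots$. Tops function: for $x\in A_{\mathcal{F}}$, $\tau_{\mathcal{F}}(x):=\max\{\sigma\in\Omega:\phi_{\mathcal{F}}(\sigma)=x\}$ (the maximum exists). The tops code space is $\Omega_{\mathcal{F}}:=\{\tau_{\mathcal{F}}(x):x\in A_{\mathcal{F}}\}$, and $\overline{\Omega}_{\mathcal{F}}$ is its closure in $(\Omega,d_\Omega)$. Address structure: $\mathcal{C}_{\mathcal{F}}:=\{\phi_{\mathcal{F}}^{-1}(\{x\})\cap\overline{\Omega}_{\mathcal{F}}:x\in A_{\mathcal{F}}\}$, a set of subsets of $\Omega$. Write $\mathcal{C}_{\mathcal{F}}\prec\mathcal{C}_{\mathcal{G}}$ if for each $S\in\mathcal{C}_{\mathcal{F}}$ there is $T\in\mathcal{C}_{\mathcal{G}}$ with $S\subset T$. The objects $\phi_{\mathcal{G}},A_{\mathcal{G}},\tau_{\mathcal{G}},\Omega_{\mathcal{G}},\overline{\Omega}_{\mathcal{G}},\mathcal{C}_{\mathcal{G}}$ are defined in the same way for $\mathcal{G}$. *)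

theory Defs
  imports "HOL-Analysis.Analysis"
begin

text \<open>
  A hyperbolic IFS on a complete metric space \<open>'a\<close> is given by its number of maps \<open>N\<close> and the
  maps \<open>f 1, \<dots>, f N\<close>; the values of \<open>f\<close> outside \<open>{1..N}\<close> are irrelevant.
\<close>

definition hyperbolic_ifs :: "nat \<Rightarrow> (nat \<Rightarrow> 'a::complete_space \<Rightarrow> 'a) \<Rightarrow> bool" where
  "hyperbolic_ifs N f \<longleftrightarrow> 1 \<le> N \<and> (\<forall>n\<in>{1..N}. \<exists>l<1. l-lipschitz_on UNIV (f n))"

text \<open>
  Positions in a code are counted from \<open>0\<close>: the entry \<open>\<sigma> k\<close> is the mathematical \<open>\<sigma>\<^sub>k\<^sub>+\<^sub>1\<close>. This is
  the reason for the exponent \<open>Suc\<close> in the metric.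
\<close>

definition code_space :: "nat \<Rightarrow> (nat \<Rightarrow> nat) set" where
  "code_space N = {\<sigma>. \<forall>k. \<sigma> k \<in> {1..N}}"

definition first_diff :: "(nat \<Rightarrow> nat) \<Rightarrow> (nat \<Rightarrow> nat) \<Rightarrow> nat" where
  "first_diff \<sigma> \<omega> = (LEAST k. \<sigma> k \<noteq> \<omega> k)"

definition code_dist :: "(nat \<Rightarrow> nat) \<Rightarrow> (nat \<Rightarrow> nat) \<Rightarrow> real" where
  "code_dist \<sigma> \<omega> = (if \<sigma> = \<omega> then 0 else 1 / 2 ^ Suc (first_diff \<sigma> \<omega>))"

text \<open>The order is reversed lexicographic: the code \<open>111\<dots>\<close> is the largest one.\<close>

definition code_less :: "(nat \<Rightarrow> nat) \<Rightarrow> (nat \<Rightarrow> nat) \<Rightarrow> bool" where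
  "code_less \<sigma> \<omega> \<longleftrightarrow> \<sigma> \<noteq> \<omega> \<and> \<sigma> (first_diff \<sigma> \<omega>) > \<omega> (first_diff \<sigma> \<omega>)"

primrec ifs_comp :: "(nat \<Rightarrow> 'a \<Rightarrow> 'a) \<Rightarrow> (nat \<Rightarrow> nat) \<Rightarrow> nat \<Rightarrow> 'a \<Rightarrow> 'a" where
  "ifs_comp f \<sigma> 0 = id"
| "ifs_comp f \<sigma> (Suc k) = ifs_comp f \<sigma> k \<circ> f (\<sigma> k)"

definition address :: "(nat \<Rightarrow> 'a::complete_space \<Rightarrow> 'a) \<Rightarrow> (nat \<Rightarrow> nat) \<Rightarrow> 'a" where
  "address f \<sigma> = (THE a. \<forall>x. (\<lambda>k. ifs_comp f \<sigma> k x) \<longlonglongrightarrow> a)"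

definition attractor :: "nat \<Rightarrow> (nat \<Rightarrow> 'a::complete_space \<Rightarrow> 'a) \<Rightarrow> 'a set" where
  "attractor N f = address f ` code_space N"

definition address_fibre ::
    "nat \<Rightarrow> (nat \<Rightarrow> 'a::complete_space \<Rightarrow> 'a) \<Rightarrow> 'a \<Rightarrow> (nat \<Rightarrow> nat) set" where
  "address_fibre N f x = {\<sigma> \<in> code_space N. address f \<sigma> = x}"

definition tops :: "nat \<Rightarrow> (nat \<Rightarrow> 'a::complete_space \<Rightarrow> 'a) \<Rightarrow> 'a \<Rightarrow> (nat \<Rightarrow> nat)" where
  "tops N f x = (THE \<sigma>. \<sigma> \<in> address_fibre N f x \<and>
     (\<forall>\<omega>\<in>address_fibre N f x. \<omega> = \<sigma> \<or> code_less \<omega> \<sigma>))"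

definition tops_code_space :: "nat \<Rightarrow> (nat \<Rightarrow> 'a::complete_space \<Rightarrow> 'a) \<Rightarrow> (nat \<Rightarrow> nat) set" where
  "tops_code_space N f = tops N f ` attractor N f"

lemma Metric_space_code_space: "Metric_space (code_space N) code_dist"
proof
  have fd_sym: "first_diff \<sigma> \<omega> = first_diff \<omega> \<sigma>" for \<sigma> \<omega>
    unfolding first_diff_def by (rule arg_cong[where f = Least]) auto
  show "0 \<le> code_dist \<sigma> \<omega>" for \<sigma> \<omega>
    by (simp add: code_dist_def)
  show "code_dist \<sigma> \<omega> = code_dist \<omega> \<sigma>" for \<sigma> \<omega>
    by (simp add: code_dist_def fd_sym)
  show "code_dist \<sigma> \<omega> = 0 \<longleftrightarrow> \<sigma> = \<omega>" for \<sigma> \<omega>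
    by (simp add: code_dist_def)
  show "code_dist \<sigma> \<rho> \<le> code_dist \<sigma> \<omega> + code_dist \<omega> \<rho>" for \<sigma> \<omega> \<rho>
  proof (cases "\<sigma> = \<omega> \<or> \<omega> = \<rho> \<or> \<sigma> = \<rho>")
    case True
    then show ?thesis by (auto simp: code_dist_def)
  next
    case False
    define k where "k = first_diff \<sigma> \<rho>"
    obtain j where "\<sigma> j \<noteq> \<rho> j"
      using False by blast
    then have "\<sigma> k \<noteq> \<rho> k"
      unfolding k_def first_diff_def by (rule LeastI)
    then have "\<sigma> k \<noteq> \<omega> k \<or> \<omega> k \<noteq> \<rho> k"
      by auto
    then have "first_diff \<sigma> \<omega> \<le> k \<or> first_diff \<omega> \<rho> \<le> k"
      unfolding first_diff_def by (auto intro: Least_le)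
    moreover have "(1::real) / 2 ^ Suc k \<le> 1 / 2 ^ Suc j" if "j \<le> k" for j
      using that by (intro divide_left_mono power_increasing) auto
    ultimately have "1 / 2 ^ Suc k \<le> code_dist \<sigma> \<omega> \<or> 1 / 2 ^ Suc k \<le> code_dist \<omega> \<rho>"
      using False unfolding code_dist_def by auto
    moreover have "code_dist \<sigma> \<rho> = 1 / 2 ^ Suc k"
      using False by (simp add: code_dist_def k_def)
    moreover have "0 \<le> code_dist \<sigma> \<omega>" "0 \<le> code_dist \<omega> \<rho>"
      by (simp_all add: code_dist_def)
    ultimately show ?thesis by linarith
  qed
qed

definition tops_closure :: "nat \<Rightarrow> (nat \<Rightarrow> 'a::complete_space \<Rightarrow> 'a) \<Rightarrow> (nat \<Rightarrow> nat) set" where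
  "tops_closure N f =
     Metric_space.mtopology (code_space N) code_dist closure_of tops_code_space N f"

definition address_structure ::
    "nat \<Rightarrow> (nat \<Rightarrow> 'a::complete_space \<Rightarrow> 'a) \<Rightarrow> (nat \<Rightarrow> nat) set set" where
  "address_structure N f = {address_fibre N f x \<inter> tops_closure N f |x. x \<in> attractor N f}"

definition address_prec :: "(nat \<Rightarrow> nat) set set \<Rightarrow> (nat \<Rightarrow> nat) set set \<Rightarrow> bool" where
  "address_prec C D \<longleftrightarrow> (\<forall>S\<in>C. \<exists>T\<in>D. S \<subseteq> T)"

definition fractal_transformation ::
    "nat \<Rightarrow> (nat \<Rightarrow> 'a::complete_space \<Rightarrow> 'a) \<Rightarrow> (nat \<Rightarrow> 'b::complete_space \<Rightarrow> 'b) \<Rightarrow> 'a \<Rightarrow> 'b" where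
  "fractal_transformation N f g = address g \<circ> tops N f"

end

theory Submission
  imports Defs
begin

text \<open>
  Write \<open>\<phi>\<^sub>F\<close> for the address map, \<open>\<tau>\<^sub>F\<close> for the tops function, \<open>T\<^sub>F\<close> for the closure of the tops
  code space and \<open>h = \<phi>\<^sub>G \<circ> \<tau>\<^sub>F\<close>.

  The theorem is a statement about quotient maps. The set \<open>T\<^sub>F\<close> is compact and \<open>\<phi>\<^sub>F\<close> maps it
  continuously onto the attractor, because it contains an address of every point; hence the attractor
  carries the quotient topology of \<open>T\<^sub>F\<close>, and \<open>h\<close> is continuous as soon as \<open>h \<circ> \<phi>\<^sub>F\<close> is continuous on
  \<open>T\<^sub>F\<close>. On \<open>T\<^sub>F\<close>, however, \<open>h \<circ> \<phi>\<^sub>F = \<phi>\<^sub>G\<close>: a code \<open>\<sigma> \<in> T\<^sub>F\<close> and the top code \<open>\<tau>\<^sub>F (\<phi>\<^sub>F \<sigma>)\<close> lie in the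
  same member of the address structure of \<open>F\<close>, which is contained in a member of the address
  structure of \<open>G\<close>, and \<open>\<phi>\<^sub>G\<close> is constant there (\<open>fractal_transformation_address\<close>).

  If both address structures agree, then so do the closures \<open>T\<^sub>F\<close> and \<open>T\<^sub>G\<close>, which are their unions,
  and the same identity with the two systems exchanged shows that \<open>\<phi>\<^sub>F \<circ> \<tau>\<^sub>G\<close> is a continuous inverse
  of \<open>h\<close>.

  The topology on codes used throughout is the product topology of \<open>nat \<Rightarrow> nat\<close>, where compactness of
  the code space is Tychonoff's theorem. It enters through three facts: the address map is continuous
  as a uniform limit of maps that depend on finitely many entries only (\<open>continuous_on_address\<close>), a
  nonempty compact set of codes has a largest element (\<open>compact_has_greatest_code\<close>), so that \<open>\<tau>\<^sub>F\<close> is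
  well defined, and closures for the code metric are closed in the product topology
  (\<open>closure_of_code_space_closed\<close>), so that \<open>T\<^sub>F\<close> is compact.
\<close>

section \<open>The topology of the code space\<close>

lemma open_code_cylinder:
  fixes \<sigma> :: "nat \<Rightarrow> nat"
  shows "open {\<omega>. \<forall>i<k. \<omega> i = \<sigma> i}"
proof -
  have "open {\<omega>. \<forall>i\<in>{..<k}. \<omega> i \<in> {\<sigma> i}}"
    by (rule product_topology_basis'[where x = "\<lambda>i. i"]) (simp_all add: open_discrete)
  then show ?thesis by (simp add: Ball_def)
qed

lemma continuous_on_finite_dependence:
  fixes h :: "(nat \<Rightarrow> nat) \<Rightarrow> 'b::topological_space"
  assumes "\<And>\<sigma> \<omega>. (\<forall>i<k. \<omega> i = \<sigma> i) \<Longrightarrow> h \<omega> = h \<sigma>"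
  shows "continuous_on S h"
  unfolding continuous_on_topological
proof (intro ballI allI impI)
  fix \<sigma> B assume "open B" "h \<sigma> \<in> B"
  moreover have "h \<omega> \<in> B" if "\<omega> \<in> {\<omega>. \<forall>i<k. \<omega> i = \<sigma> i}" for \<omega>
    using assms[of \<omega> \<sigma>] that \<open>h \<sigma> \<in> B\<close> by simp
  ultimately show "\<exists>A. open A \<and> \<sigma> \<in> A \<and> (\<forall>\<omega>\<in>S. \<omega> \<in> A \<longrightarrow> h \<omega> \<in> B)"
    using open_code_cylinder[of k \<sigma>]
    by (intro exI[of _ "{\<omega>. \<forall>i<k. \<omega> i = \<sigma> i}"]) auto
qed

lemma compact_code_space: "compact (code_space N)"
proof -
  have "compactin (product_topology (\<lambda>i::nat. euclidean) UNIV) (PiE UNIV (\<lambda>i. {1..N}))"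
    by (subst compactin_PiE) (auto intro: finite_imp_compact)
  moreover have "PiE UNIV (\<lambda>i. {1..N}) = code_space N"
    by (auto simp: code_space_def PiE_iff)
  ultimately show ?thesis
    by (simp add: euclidean_product_topology)
qed

lemma first_diff_differs:
  assumes "\<sigma> \<noteq> \<omega>"
  shows "\<sigma> (first_diff \<sigma> \<omega>) \<noteq> \<omega> (first_diff \<sigma> \<omega>)"
proof -
  obtain j where "\<sigma> j \<noteq> \<omega> j"
    using assms by blast
  then show ?thesis
    unfolding first_diff_def by (rule LeastI)
qed

lemma agree_before_first_diff: "i < first_diff \<sigma> \<omega> \<Longrightarrow> \<sigma> i = \<omega> i"
  unfolding first_diff_def using not_less_Least by blast

text \<open>This is what makes every ball of the code metric contain a cylinder. The inequality is strict
  because the code metric takes the power \<open>Suc\<close> of the first differing position, which is at least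
  \<open>k\<close>.\<close>

lemma code_dist_less_if_agree:
  assumes "\<forall>i<k. \<omega> i = \<sigma> i"
  shows "code_dist \<sigma> \<omega> < (1 / 2) ^ k"
proof (cases "\<sigma> = \<omega>")
  case True
  then show ?thesis by (simp add: code_dist_def)
next
  case False
  then have "k \<le> first_diff \<sigma> \<omega>"
    using assms first_diff_differs[of \<sigma> \<omega>] by (auto simp: not_less[symmetric])
  then have "(1 / 2 :: real) ^ Suc (first_diff \<sigma> \<omega>) < (1 / 2) ^ k"
    by (intro power_strict_decreasing) auto
  then show ?thesis
    using False by (simp add: code_dist_def power_one_over)
qed

text \<open>Every set that is open for the code metric is open in the product topology, because balls
  contain cylinders; taking complements gives the same for closed sets. The two topologies in fact
  coincide, but this inclusion is what carries compactness over to the closure of the tops code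
  space.\<close>

lemma closure_of_code_space_closed:
  "closedin (top_of_set (code_space N))
     (Metric_space.mtopology (code_space N) code_dist closure_of S)"
proof -
  interpret M: Metric_space "code_space N" code_dist
    by (rule Metric_space_code_space)
  have open_code: "openin (top_of_set (code_space N)) U" if U: "openin M.mtopology U" for U
  proof (subst openin_subopen, intro ballI)
    fix \<sigma> assume "\<sigma> \<in> U"
    then obtain r where r: "r > 0" "M.mball \<sigma> r \<subseteq> U"
      using U by (auto simp: M.openin_mtopology)
    obtain k where k: "(1 / 2) ^ k < r"
      using real_arch_pow_inv[OF \<open>r > 0\<close>, of "1 / 2"] by auto
    define V where "V = code_space N \<inter> {\<omega>. \<forall>i<k. \<omega> i = \<sigma> i}"
    have "\<sigma> \<in> code_space N"
      using U \<open>\<sigma> \<in> U\<close> by (auto simp: M.openin_mtopology)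
    moreover have "V \<subseteq> M.mball \<sigma> r"
    proof
      fix \<omega> assume "\<omega> \<in> V"
      then show "\<omega> \<in> M.mball \<sigma> r"
        using code_dist_less_if_agree[of k \<omega> \<sigma>] k \<open>\<sigma> \<in> code_space N\<close>
        by (simp add: V_def M.in_mball)
    qed
    moreover have "openin (top_of_set (code_space N)) V"
      unfolding V_def by (intro openin_open_Int open_code_cylinder)
    ultimately show "\<exists>V. openin (top_of_set (code_space N)) V \<and> \<sigma> \<in> V \<and> V \<subseteq> U"
      using r by (auto simp: V_def)
  qed
  have "closedin M.mtopology (M.mtopology closure_of S)"
    by simp
  then show ?thesis
    using open_code by (auto simp: closedin_def)
qed

section \<open>The order of codes\<close>

lemma code_less_asym: "code_less \<sigma> \<omega> \<Longrightarrow> \<not> code_less \<omega> \<sigma>"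
proof -
  have "first_diff \<sigma> \<omega> = first_diff \<omega> \<sigma>"
    unfolding first_diff_def by (rule arg_cong[where f = Least]) auto
  then show "code_less \<sigma> \<omega> \<Longrightarrow> \<not> code_less \<omega> \<sigma>"
    by (simp add: code_less_def)
qed

text \<open>Fixing entries one at a time, each as small as the previous choices permit, leads to the
  lexicographic minimum of \<open>S\<close>.\<close>

primrec greedy_codes :: "(nat \<Rightarrow> nat) set \<Rightarrow> nat \<Rightarrow> (nat \<Rightarrow> nat) set" where
  "greedy_codes S 0 = S"
| "greedy_codes S (Suc k) = {\<sigma> \<in> greedy_codes S k. \<forall>\<omega>\<in>greedy_codes S k. \<sigma> k \<le> \<omega> k}"

text \<open>The greedy sets are nested, compact and nonempty, so some code lies in all of them. It is
  lexicographically smallest, hence largest in the reversed order: another code \<open>\<omega>\<close> of \<open>S\<close> survives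
  all greedy choices up to the first position where the two differ, and loses there.\<close>

lemma compact_has_greatest_code:
  assumes "compact S" and "S \<noteq> {}"
  obtains \<sigma> where "\<sigma> \<in> S" and "\<And>\<omega>. \<omega> \<in> S \<Longrightarrow> \<omega> = \<sigma> \<or> code_less \<omega> \<sigma>"
proof -
  have nonempty: "greedy_codes S k \<noteq> {}" for k
  proof (induction k)
    case (Suc k)
    then obtain \<rho> where "\<rho> \<in> greedy_codes S k"
      by blast
    then obtain \<sigma> where "\<sigma> \<in> greedy_codes S k" "\<forall>\<omega>\<in>greedy_codes S k. \<sigma> k \<le> \<omega> k"
      using ex_has_least_nat[of "\<lambda>\<sigma>. \<sigma> \<in> greedy_codes S k" \<rho> "\<lambda>\<sigma>. \<sigma> k"] by blast
    then show ?case by auto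
  qed (use assms in simp)
  have closed: "closedin (top_of_set S) (greedy_codes S k)" for k
  proof (induction k)
    case (Suc k)
    have "closed {\<sigma>::nat \<Rightarrow> nat. \<forall>\<omega>. \<omega> \<in> greedy_codes S k \<longrightarrow> \<sigma> k \<le> \<omega> k}"
      by (intro closed_Collect_all closed_Collect_imp closed_Collect_le open_Collect_const
          continuous_on_product_coordinates continuous_on_const)
    then have "closed {\<sigma>. \<forall>\<omega>\<in>greedy_codes S k. \<sigma> k \<le> \<omega> k}"
      by (simp add: Ball_def)
    then have "closedin (top_of_set S) (S \<inter> {\<sigma>. \<forall>\<omega>\<in>greedy_codes S k. \<sigma> k \<le> \<omega> k})"
      by (rule closedin_closed_Int)
    then have "closedin (top_of_set S)
        (greedy_codes S k \<inter> (S \<inter> {\<sigma>. \<forall>\<omega>\<in>greedy_codes S k. \<sigma> k \<le> \<omega> k}))"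
      by (rule closedin_Int[OF Suc])
    moreover have "greedy_codes S k \<subseteq> S"
      using closedin_subset[OF Suc] by simp
    ultimately show ?case
      by (simp add: Int_def Int_absorb1 subset_iff cong: conj_cong)
  qed simp
  have "(\<Inter>k. greedy_codes S k) \<noteq> {}"
  proof (rule compact_space_imp_nest[OF _ closed nonempty])
    show "compact_space (top_of_set S)"
      using assms by (simp add: compact_space_subtopology)
    show "decseq (greedy_codes S)"
      by (rule decseq_SucI) auto
  qed
  then obtain \<sigma> where \<sigma>: "\<And>k. \<sigma> \<in> greedy_codes S k"
    by auto
  have "code_less \<omega> \<sigma>" if "\<omega> \<in> S" "\<omega> \<noteq> \<sigma>" for \<omega>
  proof -
    \<comment> \<open>A code that has made the same choices so far is still in the race.\<close>
    have agree: "\<omega> \<in> greedy_codes S k" if "\<forall>i<k. \<omega> i = \<sigma> i" for k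
      using that
    proof (induction k)
      case (Suc k)
      then show ?case using \<sigma>[of "Suc k"] by auto
    qed (use \<open>\<omega> \<in> S\<close> in simp)
    define k where "k = first_diff \<omega> \<sigma>"
    have "\<omega> \<in> greedy_codes S k"
      by (intro agree) (simp add: k_def agree_before_first_diff)
    then have "\<sigma> k \<le> \<omega> k"
      using \<sigma>[of "Suc k"] by auto
    moreover have "\<omega> k \<noteq> \<sigma> k"
      unfolding k_def by (rule first_diff_differs) fact
    ultimately show ?thesis
      using \<open>\<omega> \<noteq> \<sigma>\<close> by (simp add: code_less_def k_def)
  qed
  with \<sigma>[of 0] show thesis
    by (intro that) auto
qed

section \<open>The address map\<close>

lemma hyperbolic_ifs_uniform_ratio:
  assumes "hyperbolic_ifs N f"
  obtains l where "0 \<le> l" "l < 1"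
    "\<And>n x y. n \<in> {1..N} \<Longrightarrow> dist (f n x) (f n y) \<le> l * dist x y"
proof -
  obtain L where L: "\<forall>n\<in>{1..N}. L n < 1 \<and> (L n)-lipschitz_on UNIV (f n)"
    using assms unfolding hyperbolic_ifs_def by metis
  define l where "l = Max (insert 0 (L ` {1..N}))"
  have "dist (f n x) (f n y) \<le> l * dist x y" if "n \<in> {1..N}" for n x y
  proof -
    have "dist (f n x) (f n y) \<le> L n * dist x y"
      using L that lipschitz_onD by blast
    also have "\<dots> \<le> l * dist x y"
      using that by (intro mult_right_mono) (auto simp: l_def simp del: Max_insert intro!: Max_ge)
    finally show ?thesis .
  qed
  moreover have "0 \<le> l" "l < 1"
    using L by (auto simp: l_def)
  ultimately show thesis using that by blast
qed

text \<open>The outermost maps come first in the code, so splitting a composition shifts the code of the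
  inner factor. With \<open>m = 1\<close> this peels off the outermost map.\<close>

lemma ifs_comp_add: "ifs_comp f \<sigma> (m + j) = ifs_comp f \<sigma> m \<circ> ifs_comp f (\<lambda>i. \<sigma> (m + i)) j"
  by (induction j) (auto simp: fun_eq_iff)

lemma ifs_comp_cong: "(\<forall>i<k. \<omega> i = \<sigma> i) \<Longrightarrow> ifs_comp f \<omega> k = ifs_comp f \<sigma> k"
  by (induction k) auto

lemma ifs_comp_contracts:
  assumes "0 \<le> l" "\<And>n x y. n \<in> {1..N} \<Longrightarrow> dist (f n x) (f n y) \<le> l * dist x y"
    and "\<sigma> \<in> code_space N"
  shows "dist (ifs_comp f \<sigma> k x) (ifs_comp f \<sigma> k y) \<le> l ^ k * dist x y"
proof (induction k arbitrary: x y)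
  case (Suc k)
  have "dist (ifs_comp f \<sigma> (Suc k) x) (ifs_comp f \<sigma> (Suc k) y)
      \<le> l ^ k * dist (f (\<sigma> k) x) (f (\<sigma> k) y)"
    using Suc by simp
  also have "\<dots> \<le> l ^ k * (l * dist x y)"
    using assms by (intro mult_left_mono assms) (auto simp: code_space_def)
  finally show ?case by (simp add: mult_ac)
qed simp

text \<open>If all maps displace \<open>x\<close> by at most \<open>D\<close>, then the ball around \<open>x\<close> of radius \<open>B = D / (1 - l)\<close> is
  mapped into itself by each of them, since \<open>l * B + D = B\<close>. It therefore contains all orbits of \<open>x\<close>.\<close>

lemma ifs_comp_bounded:
  assumes "0 \<le> l" "l < 1" "\<And>n x y. n \<in> {1..N} \<Longrightarrow> dist (f n x) (f n y) \<le> l * dist x y"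
  obtains B where "\<And>\<sigma> k. \<sigma> \<in> code_space N \<Longrightarrow> dist (ifs_comp f \<sigma> k x) x \<le> B"
proof -
  define D where "D = Max (insert 0 ((\<lambda>n. dist (f n x) x) ` {1..N}))"
  have D: "0 \<le> D" "n \<in> {1..N} \<Longrightarrow> dist (f n x) x \<le> D" for n
    unfolding D_def by (auto intro!: Max_ge simp del: Max_insert)
  define B where "B = D / (1 - l)"
  have B: "0 \<le> B" "l * B + D = B"
    using D \<open>l < 1\<close> by (auto simp: B_def field_simps)
  have "dist (ifs_comp f \<sigma> k x) x \<le> B" if "\<sigma> \<in> code_space N" for \<sigma> k
    using that
  proof (induction k arbitrary: \<sigma>)
    case (Suc k)
    define y where "y = ifs_comp f (\<lambda>i. \<sigma> (1 + i)) k x"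
    have "dist y x \<le> B"
      unfolding y_def using Suc.prems by (intro Suc.IH) (auto simp: code_space_def)
    have \<sigma>0: "\<sigma> 0 \<in> {1..N}"
      using Suc.prems by (auto simp: code_space_def)
    have "ifs_comp f \<sigma> (Suc k) x = f (\<sigma> 0) y"
      using ifs_comp_add[of f \<sigma> 1 k] by (simp add: y_def)
    then have "dist (ifs_comp f \<sigma> (Suc k) x) x \<le> dist (f (\<sigma> 0) y) (f (\<sigma> 0) x) + dist (f (\<sigma> 0) x) x"
      by (simp add: dist_triangle)
    also have "\<dots> \<le> l * dist y x + D"
      using assms(3)[OF \<sigma>0] D(2)[OF \<sigma>0] by (intro add_mono)
    also have "\<dots> \<le> B"
      using mult_left_mono[OF \<open>dist y x \<le> B\<close> \<open>0 \<le> l\<close>] B(2) by linarith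
    finally show ?case .
  qed (use B in simp)
  then show thesis using that by blast
qed

text \<open>The points of an orbit from step \<open>m\<close> on all lie in the image of one bounded set under a
  composition of \<open>m\<close> maps, so their distances are at most \<open>l\<^sup>m\<close> times a bound that does not depend on
  the code.\<close>

lemma uniformly_convergent_ifs_comp:
  fixes f :: "nat \<Rightarrow> 'a::complete_space \<Rightarrow> 'a"
  assumes "hyperbolic_ifs N f"
  shows "uniformly_convergent_on (code_space N) (\<lambda>k \<sigma>. ifs_comp f \<sigma> k x)"
proof (intro Cauchy_uniformly_convergent uniformly_Cauchy_onI')
  fix e :: real assume "e > 0"
  obtain l where l: "0 \<le> l" "l < 1"
    "\<And>n x y. n \<in> {1..N} \<Longrightarrow> dist (f n x) (f n y) \<le> l * dist x y"
    using hyperbolic_ifs_uniform_ratio[OF assms] by blast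
  obtain B where B: "\<And>\<sigma> k. \<sigma> \<in> code_space N \<Longrightarrow> dist (ifs_comp f \<sigma> k x) x \<le> B"
    using ifs_comp_bounded[where f = f and x = x, OF l] by blast
  have "(\<lambda>m. l ^ m * B) \<longlonglongrightarrow> 0"
    using l by (intro tendsto_mult_left_zero LIMSEQ_power_zero) auto
  then have "\<forall>\<^sub>F m in sequentially. l ^ m * B < e"
    using \<open>e > 0\<close> by (rule order_tendstoD)
  then obtain M where M: "\<And>m. m \<ge> M \<Longrightarrow> l ^ m * B < e"
    by (auto simp: eventually_sequentially)
  have "dist (ifs_comp f \<sigma> m x) (ifs_comp f \<sigma> n x) < e"
    if "\<sigma> \<in> code_space N" "m \<ge> M" "n > m" for \<sigma> m n
  proof -
    define y where "y = ifs_comp f (\<lambda>i. \<sigma> (m + i)) (n - m) x"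
    have "ifs_comp f \<sigma> n x = ifs_comp f \<sigma> m y"
      using ifs_comp_add[of f \<sigma> m "n - m"] \<open>n > m\<close> by (simp add: y_def)
    then have "dist (ifs_comp f \<sigma> m x) (ifs_comp f \<sigma> n x) \<le> l ^ m * dist y x"
      using ifs_comp_contracts[OF l(1,3) that(1)] by (simp add: dist_commute)
    also have "\<dots> \<le> l ^ m * B"
      unfolding y_def using l(1) that(1) by (intro mult_left_mono B) (auto simp: code_space_def)
    also have "\<dots> < e"
      using M that(2) .
    finally show ?thesis .
  qed
  then show "\<exists>M. \<forall>\<sigma>\<in>code_space N. \<forall>m\<ge>M. \<forall>n>m. dist (ifs_comp f \<sigma> m x) (ifs_comp f \<sigma> n x) < e"
    by blast
qed

text \<open>The limit along one orbit is the limit along all of them, because two orbits with the same code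
  approach each other like \<open>l\<^sup>k\<close>. Hence the description defining the address is unique.\<close>

lemma tendsto_address:
  fixes f :: "nat \<Rightarrow> 'a::complete_space \<Rightarrow> 'a"
  assumes "hyperbolic_ifs N f" and "\<sigma> \<in> code_space N"
  shows "(\<lambda>k. ifs_comp f \<sigma> k x) \<longlonglongrightarrow> address f \<sigma>"
proof -
  obtain l where l: "0 \<le> l" "l < 1"
    "\<And>n x y. n \<in> {1..N} \<Longrightarrow> dist (f n x) (f n y) \<le> l * dist x y"
    using hyperbolic_ifs_uniform_ratio[OF assms(1)] by blast
  obtain \<phi> where "uniform_limit (code_space N) (\<lambda>k \<sigma>. ifs_comp f \<sigma> k x) \<phi> sequentially"
    using uniformly_convergent_ifs_comp[OF assms(1)] unfolding uniformly_convergent_on_def by blast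
  then obtain a where a: "(\<lambda>k. ifs_comp f \<sigma> k x) \<longlonglongrightarrow> a"
    using tendsto_uniform_limitI[OF _ assms(2)] by blast
  have lim: "(\<lambda>k. ifs_comp f \<sigma> k y) \<longlonglongrightarrow> a" for y
  proof (rule metric_tendsto_imp_tendsto)
    have "(\<lambda>k. l ^ k * dist y x) \<longlonglongrightarrow> 0"
      using l by (intro tendsto_mult_left_zero LIMSEQ_power_zero) auto
    moreover have "(\<lambda>k. dist (ifs_comp f \<sigma> k x) a) \<longlonglongrightarrow> 0"
      using a by (rule iffD1[OF tendsto_dist_iff])
    ultimately show "(\<lambda>k. l ^ k * dist y x + dist (ifs_comp f \<sigma> k x) a) \<longlonglongrightarrow> 0"
      by (rule tendsto_add_zero)
    have "dist (ifs_comp f \<sigma> k y) a \<le> l ^ k * dist y x + dist (ifs_comp f \<sigma> k x) a" for k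
      using ifs_comp_contracts[where f = f and k = k and x = y and y = x, OF l(1,3) assms(2)]
        dist_triangle[of "ifs_comp f \<sigma> k y" a "ifs_comp f \<sigma> k x"] by linarith
    then show "\<forall>\<^sub>F k in sequentially. dist (ifs_comp f \<sigma> k y) a
        \<le> dist (l ^ k * dist y x + dist (ifs_comp f \<sigma> k x) a) 0"
      using l(1) by simp
  qed
  have "address f \<sigma> = a"
    unfolding address_def
  proof (rule the_equality)
    show "b = a" if "\<forall>y. (\<lambda>k. ifs_comp f \<sigma> k y) \<longlonglongrightarrow> b" for b
      using that a LIMSEQ_unique by blast
  qed (use lim in blast)
  with a show ?thesis by simp
qed

lemma continuous_on_address:
  fixes f :: "nat \<Rightarrow> 'a::complete_space \<Rightarrow> 'a"
  assumes "hyperbolic_ifs N f"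
  shows "continuous_on (code_space N) (address f)"
proof -
  fix x :: 'a
  obtain a where a: "uniform_limit (code_space N) (\<lambda>k \<sigma>. ifs_comp f \<sigma> k x) a sequentially"
    using uniformly_convergent_ifs_comp[OF assms] unfolding uniformly_convergent_on_def by blast
  have "continuous_on (code_space N) a"
  proof (rule uniform_limit_theorem[OF _ a])
    show "\<forall>\<^sub>F k in sequentially. continuous_on (code_space N) (\<lambda>\<sigma>. ifs_comp f \<sigma> k x)"
    proof (intro always_eventually allI)
      show "continuous_on (code_space N) (\<lambda>\<sigma>. ifs_comp f \<sigma> k x)" for k
        by (rule continuous_on_finite_dependence[where k = k]) (metis ifs_comp_cong)
    qed
  qed simp
  moreover have "a \<sigma> = address f \<sigma>" if "\<sigma> \<in> code_space N" for \<sigma>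
    using tendsto_uniform_limitI[OF a that] tendsto_address[OF assms that] LIMSEQ_unique by blast
  ultimately show ?thesis
    by (simp cong: continuous_on_cong)
qed

section \<open>The tops function\<close>

text \<open>The fibre is compact, as the preimage of a point under the continuous address map, so its
  maximum exists; it is unique by asymmetry of the order.\<close>

lemma tops_in_address_fibre:
  fixes f :: "nat \<Rightarrow> 'a::complete_space \<Rightarrow> 'a"
  assumes "hyperbolic_ifs N f" and "x \<in> attractor N f"
  shows "tops N f x \<in> address_fibre N f x"
proof -
  have "closedin (top_of_set (code_space N)) (code_space N \<inter> address f -` {x})"
    by (intro continuous_closedin_preimage continuous_on_address assms closed_singleton)
  moreover have "code_space N \<inter> address f -` {x} = address_fibre N f x"
    by (auto simp: address_fibre_def)
  ultimately have "compact (address_fibre N f x)"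
    using closedin_compact[OF compact_code_space] by metis
  moreover have "address_fibre N f x \<noteq> {}"
    using assms(2) by (auto simp: attractor_def address_fibre_def)
  ultimately obtain \<sigma> where \<sigma>: "\<sigma> \<in> address_fibre N f x"
    "\<And>\<omega>. \<omega> \<in> address_fibre N f x \<Longrightarrow> \<omega> = \<sigma> \<or> code_less \<omega> \<sigma>"
    by (rule compact_has_greatest_code) blast
  have "tops N f x = \<sigma>"
    unfolding tops_def
  proof (rule the_equality)
    fix \<rho> assume \<rho>: "\<rho> \<in> address_fibre N f x \<and>
      (\<forall>\<omega>\<in>address_fibre N f x. \<omega> = \<rho> \<or> code_less \<omega> \<rho>)"
    then have "\<sigma> = \<rho> \<or> code_less \<sigma> \<rho>"
      using \<sigma>(1) by blast
    moreover have "\<rho> = \<sigma> \<or> code_less \<rho> \<sigma>"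
      using \<rho> \<sigma>(2) by blast
    ultimately show "\<rho> = \<sigma>"
      using code_less_asym[of \<rho> \<sigma>] by blast
  qed (use \<sigma> in simp)
  with \<sigma> show ?thesis by simp
qed

lemma tops_code_space_subset_tops_closure:
  fixes f :: "nat \<Rightarrow> 'a::complete_space \<Rightarrow> 'a"
  assumes "hyperbolic_ifs N f"
  shows "tops_code_space N f \<subseteq> tops_closure N f"
proof -
  interpret M: Metric_space "code_space N" code_dist
    by (rule Metric_space_code_space)
  have "tops_code_space N f \<subseteq> code_space N"
    using tops_in_address_fibre[OF assms]
    by (auto simp: tops_code_space_def address_fibre_def)
  then show ?thesis
    unfolding tops_closure_def by (intro closure_of_subset) simp
qed

lemma tops_closure_subset_code_space: "tops_closure N f \<subseteq> code_space N"
  using closedin_subset[OF closure_of_code_space_closed]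
  by (simp add: tops_closure_def)

lemma compact_tops_closure: "compact (tops_closure N f)"
  unfolding tops_closure_def
  by (rule closedin_compact[OF compact_code_space closure_of_code_space_closed])

lemma address_image_tops_closure:
  fixes f :: "nat \<Rightarrow> 'a::complete_space \<Rightarrow> 'a"
  assumes "hyperbolic_ifs N f"
  shows "address f ` tops_closure N f = attractor N f"
proof
  show "address f ` tops_closure N f \<subseteq> attractor N f"
    using tops_closure_subset_code_space by (auto simp: attractor_def)
  show "attractor N f \<subseteq> address f ` tops_closure N f"
  proof
    fix x assume x: "x \<in> attractor N f"
    then have "x = address f (tops N f x)"
      using tops_in_address_fibre[OF assms] by (auto simp: address_fibre_def)
    moreover have "tops N f x \<in> tops_closure N f"
      using x tops_code_space_subset_tops_closure[OF assms] by (auto simp: tops_code_space_def)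
    ultimately show "x \<in> address f ` tops_closure N f" by blast
  qed
qed

text \<open>The address structure remembers the closure of the tops code space: it partitions it into the
  fibres of the address map.\<close>

lemma Union_address_structure: "\<Union> (address_structure N f) = tops_closure N f"
proof
  show "\<Union> (address_structure N f) \<subseteq> tops_closure N f"
    by (auto simp: address_structure_def)
  show "tops_closure N f \<subseteq> \<Union> (address_structure N f)"
  proof
    fix \<sigma> assume \<sigma>: "\<sigma> \<in> tops_closure N f"
    then have "\<sigma> \<in> code_space N"
      using tops_closure_subset_code_space by blast
    then have "address f \<sigma> \<in> attractor N f" "\<sigma> \<in> address_fibre N f (address f \<sigma>)"
      by (simp_all add: attractor_def address_fibre_def)
    with \<sigma> show "\<sigma> \<in> \<Union> (address_structure N f)"
      unfolding address_structure_def by blast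
  qed
qed

section \<open>Fractal transformations\<close>

text \<open>This is the only place where the relation between the address structures is used. The code
  \<open>\<sigma>\<close> and the top code of the point that it addresses lie in one member of the structure of \<open>f\<close>;
  that member is contained in a single fibre of the address map of \<open>g\<close>.\<close>

lemma fractal_transformation_address:
  fixes f :: "nat \<Rightarrow> 'a::complete_space \<Rightarrow> 'a" and g :: "nat \<Rightarrow> 'b::complete_space \<Rightarrow> 'b"
  assumes "hyperbolic_ifs N f"
    and "address_prec (address_structure N f) (address_structure N g)"
    and "\<sigma> \<in> tops_closure N f"
  shows "fractal_transformation N f g (address f \<sigma>) = address g \<sigma>"
proof -
  define x where "x = address f \<sigma>"
  define S where "S = address_fibre N f x \<inter> tops_closure N f"
  have \<sigma>: "\<sigma> \<in> code_space N"
    using assms(3) tops_closure_subset_code_space by blast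
  then have x: "x \<in> attractor N f"
    by (auto simp: attractor_def x_def)
  then have "S \<in> address_structure N f"
    by (auto simp: address_structure_def S_def)
  then obtain U where "U \<in> address_structure N g" "S \<subseteq> U"
    using assms(2) unfolding address_prec_def by blast
  then obtain y where y: "S \<subseteq> address_fibre N g y"
    by (auto simp: address_structure_def)
  have "tops N f x \<in> S"
    using tops_in_address_fibre[OF assms(1) x] tops_code_space_subset_tops_closure[OF assms(1)] x
    by (auto simp: S_def tops_code_space_def)
  moreover have "\<sigma> \<in> S"
    using assms(3) \<sigma> by (auto simp: S_def x_def address_fibre_def)
  ultimately have "address g (tops N f x) = address g \<sigma>"
    using y by (auto simp: address_fibre_def)
  then show ?thesis
    by (simp add: fractal_transformation_def x_def)
qed

lemma fractal_transformation_in_attractor: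
  fixes f :: "nat \<Rightarrow> 'a::complete_space \<Rightarrow> 'a" and g :: "nat \<Rightarrow> 'b::complete_space \<Rightarrow> 'b"
  assumes "hyperbolic_ifs N f" "x \<in> attractor N f"
  shows "fractal_transformation N f g x \<in> attractor N g"
proof -
  have "tops N f x \<in> code_space N"
    using tops_in_address_fibre[OF assms] by (simp add: address_fibre_def)
  then show ?thesis
    unfolding fractal_transformation_def attractor_def comp_apply by (rule imageI)
qed

text \<open>A continuous map from a compact space onto a Hausdorff space is a quotient map, so continuity
  may be tested after composing with the address map of \<open>f\<close>, and there the composite is the address
  map of \<open>g\<close>.\<close>

lemma continuous_on_fractal_transformation:
  fixes f :: "nat \<Rightarrow> 'a::complete_space \<Rightarrow> 'a" and g :: "nat \<Rightarrow> 'b::complete_space \<Rightarrow> 'b"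
  assumes "hyperbolic_ifs N f" and "hyperbolic_ifs N g"
    and "address_prec (address_structure N f) (address_structure N g)"
  shows "continuous_on (attractor N f) (fractal_transformation N f g)"
proof -
  let ?T = "tops_closure N f" and ?h = "fractal_transformation N f g"
  have cont: "continuous_on ?T (address f)" "continuous_on ?T (address g)"
    using continuous_on_subset[OF continuous_on_address tops_closure_subset_code_space] assms
    by blast+
  have image: "address f ` ?T = attractor N f"
    by (rule address_image_tops_closure) fact
  have "quotient_map (top_of_set ?T) (top_of_set (attractor N f)) (address f)"
    using image cont(1) compact_tops_closure[of N f]
    by (intro continuous_imp_quotient_map)
      (auto simp: compact_space_subtopology Hausdorff_space_subtopology)
  moreover have "continuous_map (top_of_set ?T) euclidean (?h \<circ> address f)"
    using cont(2) fractal_transformation_address[OF assms(1,3)]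
    by (simp cong: continuous_on_cong)
  ultimately have "continuous_map (top_of_set (attractor N f)) euclidean ?h"
    by (rule continuous_compose_quotient_map)
  then show ?thesis by simp
qed

text \<open>A point \<open>x\<close> has an address \<open>\<sigma>\<close> in the common closure of the two tops code spaces. The
  transformations carry \<open>x\<close> to the point of the other attractor with address \<open>\<sigma>\<close>, and back.\<close>

lemma fractal_transformation_inverse:
  fixes f :: "nat \<Rightarrow> 'a::complete_space \<Rightarrow> 'a" and g :: "nat \<Rightarrow> 'b::complete_space \<Rightarrow> 'b"
  assumes "hyperbolic_ifs N f" and "hyperbolic_ifs N g"
    and eq: "address_structure N f = address_structure N g"
    and "x \<in> attractor N f"
  shows "fractal_transformation N g f (fractal_transformation N f g x) = x"
proof -
  have prec: "address_prec (address_structure N f) (address_structure N g)"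
    "address_prec (address_structure N g) (address_structure N f)"
    by (auto simp: eq address_prec_def)
  obtain \<sigma> where \<sigma>: "\<sigma> \<in> tops_closure N f" "x = address f \<sigma>"
    using address_image_tops_closure[OF assms(1)] assms(4) by auto
  then have "\<sigma> \<in> tops_closure N g"
    using eq Union_address_structure by metis
  with \<sigma> show ?thesis
    using fractal_transformation_address[OF assms(1) prec(1)]
      fractal_transformation_address[OF assms(2) prec(2)] by simp
qed

theorem theorem1:
  fixes f :: "nat \<Rightarrow> 'a::complete_space \<Rightarrow> 'a"
    and g :: "nat \<Rightarrow> 'b::complete_space \<Rightarrow> 'b"
    and N :: nat
  assumes "hyperbolic_ifs N f" and "hyperbolic_ifs N g"
    and "address_prec (address_structure N f) (address_structure N g)"
  shows "fractal_transformation N f g \<in> attractor N f \<rightarrow> attractor N g \<and>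
    continuous_on (attractor N f) (fractal_transformation N f g) \<and>
    (address_structure N f = address_structure N g \<longrightarrow>
      (\<exists>h. homeomorphism (attractor N f) (attractor N g) (fractal_transformation N f g) h))"
proof (intro conjI impI)
  let ?h = "fractal_transformation N f g" and ?h' = "fractal_transformation N g f"
  show maps: "?h \<in> attractor N f \<rightarrow> attractor N g"
    using fractal_transformation_in_attractor[OF assms(1)] by (intro Pi_I)
  show cont: "continuous_on (attractor N f) ?h"
    by (rule continuous_on_fractal_transformation[OF assms])
  assume eq: "address_structure N f = address_structure N g"
  have "homeomorphism (attractor N f) (attractor N g) ?h ?h'"
  proof (rule homeomorphismI)
    have "address_prec (address_structure N g) (address_structure N f)"
      using assms(3) by (simp only: eq)
    then show "continuous_on (attractor N g) ?h'"
      by (rule continuous_on_fractal_transformation[OF assms(2,1)])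
    show "?h ` attractor N f \<subseteq> attractor N g"
      using maps by (rule funcset_image)
    show "?h' ` attractor N g \<subseteq> attractor N f"
      using fractal_transformation_in_attractor[OF assms(2)] by (intro image_subsetI)
    show "?h' (?h x) = x" if "x \<in> attractor N f" for x
      by (rule fractal_transformation_inverse[OF assms(1,2) eq that])
    show "?h (?h' y) = y" if "y \<in> attractor N g" for y
      by (rule fractal_transformation_inverse[OF assms(2,1) eq[symmetric] that])
  qed (rule cont)
  then show "\<exists>h. homeomorphism (attractor N f) (attractor N g) ?h h"
    by (rule exI[of _ ?h'])
qed

end
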